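(* Let $\langle v_i\rangle_{i\ge1}$ and $\langle\pi_i\rangle_{i\ge0}$ be the sequences generated by DPI or by IPI, starting from an admissible policy $\pi_0$ and under the boundary condition that, for every $i\in\mathbb N$, if $\pi_{i-1}$ is admissible then $\lim_{t\to\infty}\mathbb G_{\pi_{i-1}}^x[\gamma^tv_i(X_t)]=0$ for all $x\in\mathcal X$. Let $\hat v_*(x)=\sup_{i\in\mathbb N}v_i(x)$ and let $\mathcal T:\mathcal V_{\mathsf a}\to\mathcal V_{\mathsf a}$ be the associated policy iteration operator. Suppose $\hat v_*\in\mathcal V_{\mathsf a}$ and that for each compact subset $\Omega$ of $\mathcal X$, $\mathcal T$ is continuous under the pseudometric $d_\Omega(v,w)=\sup\{|v(x)-w(x)|:x\in\Omega\}$ on $\mathcal V_{\mathsf a}$. If $\mathcal T$ has a unique fixed point $v^*$, then $v_i\to v^*$ locally uniformly and $v^*=\hat v_*$.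
   Context: State space $\mathcal X=\mathbb R^l$, $\mathcal X^{\mathsf T}=\mathbb R^{1\times l}$, time space $\mathbb T=[0,\infty)$. The action space $\mathcal U\subseteq\mathbb R^m$ is an $m$-dimensional manifold with or without boundary, meaning $\mathcal U=O\cup\partial O$ or $\mathcal U=O$ for some open $O\subseteq\mathbb R^m$. The environment is $\dot X_t=f(X_t,U_t)$, with $f:\mathcal X\times\mathcal U\to\mathcal X$ continuous and $t\mapsto U_t\in\mathcal U$ continuous; it is a standing assumption that the state trajectory $t\mapsto X_t$ is uniquely defined over all of $\mathbb T$ (for every initial state, in particular under every policy). A policy is a continuous function $\pi:\mathcal X\to\mathcal U$. $\mathbb G_\pi^x[Y]$ denotes the value of $Y$ when $X_0=x$ and $U_t=\pi(X_t)$ for all $t\in\mathbb T$. The reward function $r:\mathcal X\times\mathcal U\to\mathbb R$ is continuous, $R_t=r(X_t,U_t)$; $\gamma\in(0,1]$ is the discount factor and $\alpha=-\ln\gamma\ge0$. Standing assumption: $r$ attains a maximum $r_{\mathsf{max}}$, and $r_{\mathsf{max}}=0$ if $\gamma=1$. The value function (VF) of $\pi$ is $v_\pi(x)=\mathbb G_\pi^x[\int_0^\infty\gamma^tR_t\,dt]\in[-\infty,\infty)$. A policy $\pi$ (and its VF) is admissible iff $v_\pi(x)$ is finite for all $x\in\mathcal X$; $\Pi_{\mathsf a}$, $\mathcal V_{\mathsf a}$ are the sets of admissible policies and admissible VFs. Standing assumption: at least one admissible policy exists, and every admissible VF is $\mathrm C^1$. Gradients are row vectors, and the Hamiltonian is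 $h(x,u,p)=r(x,u)+p\,f(x,u)$. Standing assumption: there is a continuous $u_*:\mathcal X\times\mathcal X^{\mathsf T}\to\mathcal U$ with $u_*(x,p)\in\arg\max_{u\in\mathcal U}h(x,u,p)$ for all $(x,p)$. A maximal policy over $\pi\in\Pi_{\mathsf a}$ is a policy $\pi'$ with $\pi'(x)\in\arg\max_{u\in\mathcal U}h(x,u,\nabla v_\pi(x))$ for all $x$ (it is again admissible, with $v_\pi\le v_{\pi'}$). DPI (differential policy iteration): given an admissible policy $\pi_0$, for $i=1,2,\dots$: (evaluation) $v_i:\mathcal X\to\mathbb R$ is a $\mathrm C^1$ function with $\alpha v_i(x)=h(x,\pi_{i-1}(x),\nabla v_i(x))$ for all $x$; (improvement) $\pi_i$ is a policy with $\pi_i(x)\in\arg\max_{u\in\mathcal U}h(x,u,\nabla v_i(x))$ for all $x$. IPI (integral policy iteration): given an admissible policy $\pi_0$ and a fixed $\eta>0$, for $i=1,2,\dots$: (evaluation) $v_i:\mathcal X\to\mathbb R$ is a $\mathrm C^1$ function with $v_i(x)=\mathbb G_{\pi_{i-1}}^x[\int_0^\eta\gamma^tR_t\,dt+\gamma^\eta v_i(X_\eta)]$ for all $x$; (improvement) $\pi_i$ is a policy with $\pi_i(x)\in\arg\max_{u\in\mathcal U}[r(x,u)+\nabla v_i(x)f_{\mathsf c}(x,u)]$ for all $x$, where $f(x,u)=f_{\mathsf d}(x)+f_{\mathsf c}(x,u)$ with $f_{\mathsf d},f_{\mathsf c}$ continuous (the same argmax set as for $h(x,\cdot,\nabla v_i(x))$).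 Under the boundary condition in the claim, $\pi_{i-1}\in\Pi_{\mathsf a}$ and $v_i=v_{\pi_{i-1}}$ for all $i\in\mathbb N$. Policy iteration operator: $\mathcal T:\mathcal V_{\mathsf a}\to\mathcal V_{\mathsf a}$ is a map with $\mathcal Tv_{\pi_{i-1}}=v_{\pi_i}$ for every $i\in\mathbb N$, and $\mathcal Tv_\pi=v_{\pi'}$ for any other $v_\pi\in\mathcal V_{\mathsf a}$, where $\pi'$ is a (chosen) maximal policy over $\pi$. Thus $v_i=\mathcal T^{i-1}v_1$. Locally uniform convergence means each $x\in\mathcal X$ has a neighborhood on which convergence is uniform. *)

theory Defs
  imports "HOL-Analysis.Analysis"
begin

definition policy :: "(real ^ 'm) set \<Rightarrow> (real ^ 'l \<Rightarrow> real ^ 'm) \<Rightarrow> bool" where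
  "policy U \<pi> \<longleftrightarrow> continuous_on UNIV \<pi> \<and> range \<pi> \<subseteq> U"

definition state_trajectory ::
  "(real ^ 'l \<Rightarrow> real ^ 'm \<Rightarrow> real ^ 'l) \<Rightarrow> (real \<Rightarrow> real ^ 'm) \<Rightarrow> real ^ 'l \<Rightarrow> (real \<Rightarrow> real ^ 'l) \<Rightarrow> bool"
where
  "state_trajectory f u x X \<longleftrightarrow>
     X 0 = x \<and> (\<forall>t\<ge>0. (X has_vector_derivative f (X t) (u t)) (at t within {0..}))"

text \<open>The state trajectory from \<open>x\<close> with actions \<open>U\<^sub>t = \<pi> (X\<^sub>t)\<close>. Only its values at
  times \<open>t \<ge> 0\<close> are meaningful; these are unique under the standing assumptions below.\<close>

definition traj ::
  "(real ^ 'l \<Rightarrow> real ^ 'm \<Rightarrow> real ^ 'l) \<Rightarrow> (real ^ 'l \<Rightarrow> real ^ 'm) \<Rightarrow> real ^ 'l \<Rightarrow> real \<Rightarrow> real ^ 'l"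
where
  "traj f \<pi> x = (SOME X. state_trajectory f (\<lambda>t. \<pi> (X t)) x X)"

definition discounted_return ::
  "(real ^ 'l \<Rightarrow> real ^ 'm \<Rightarrow> real ^ 'l) \<Rightarrow> (real ^ 'l \<Rightarrow> real ^ 'm \<Rightarrow> real) \<Rightarrow> real \<Rightarrow>
   (real ^ 'l \<Rightarrow> real ^ 'm) \<Rightarrow> real ^ 'l \<Rightarrow> real \<Rightarrow> real"
where
  "discounted_return f r \<gamma> \<pi> x s =
     integral {0..s} (\<lambda>t. \<gamma> powr t * r (traj f \<pi> x t) (\<pi> (traj f \<pi> x t)))"

text \<open>The integral over \<open>[0, \<infinity>)\<close> is the limit of the integrals over \<open>[0, s]\<close>. The limit exists
  in \<open>[-\<infinity>, \<infinity>)\<close> under the standing assumptions, because \<open>r\<close> is bounded above by its maximum and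
  this maximum is \<open>0\<close> when \<open>\<gamma> = 1\<close>.\<close>

definition value_fun ::
  "(real ^ 'l \<Rightarrow> real ^ 'm \<Rightarrow> real ^ 'l) \<Rightarrow> (real ^ 'l \<Rightarrow> real ^ 'm \<Rightarrow> real) \<Rightarrow> real \<Rightarrow>
   (real ^ 'l \<Rightarrow> real ^ 'm) \<Rightarrow> real ^ 'l \<Rightarrow> ereal"
where
  "value_fun f r \<gamma> \<pi> x = Lim at_top (\<lambda>s. ereal (discounted_return f r \<gamma> \<pi> x s))"

definition admissible ::
  "(real ^ 'm) set \<Rightarrow> (real ^ 'l \<Rightarrow> real ^ 'm \<Rightarrow> real ^ 'l) \<Rightarrow> (real ^ 'l \<Rightarrow> real ^ 'm \<Rightarrow> real) \<Rightarrow> real \<Rightarrow>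
   (real ^ 'l \<Rightarrow> real ^ 'm) \<Rightarrow> bool"
where
  "admissible U f r \<gamma> \<pi> \<longleftrightarrow> policy U \<pi> \<and> (\<forall>x. \<bar>value_fun f r \<gamma> \<pi> x\<bar> \<noteq> \<infinity>)"

text \<open>The value function as a real-valued function; used for admissible policies only.\<close>

definition real_value_fun ::
  "(real ^ 'l \<Rightarrow> real ^ 'm \<Rightarrow> real ^ 'l) \<Rightarrow> (real ^ 'l \<Rightarrow> real ^ 'm \<Rightarrow> real) \<Rightarrow> real \<Rightarrow>
   (real ^ 'l \<Rightarrow> real ^ 'm) \<Rightarrow> real ^ 'l \<Rightarrow> real"
where
  "real_value_fun f r \<gamma> \<pi> x = real_of_ereal (value_fun f r \<gamma> \<pi> x)"

definition admissible_VFs ::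
  "(real ^ 'm) set \<Rightarrow> (real ^ 'l \<Rightarrow> real ^ 'm \<Rightarrow> real ^ 'l) \<Rightarrow> (real ^ 'l \<Rightarrow> real ^ 'm \<Rightarrow> real) \<Rightarrow> real \<Rightarrow>
   (real ^ 'l \<Rightarrow> real) set"
where
  "admissible_VFs U f r \<gamma> = {real_value_fun f r \<gamma> \<pi> | \<pi>. admissible U f r \<gamma> \<pi>}"

definition C1_fun :: "(real ^ 'l \<Rightarrow> real) \<Rightarrow> bool" where
  "C1_fun v \<longleftrightarrow> (\<exists>g. (\<forall>x. GDERIV v x :> g x) \<and> continuous_on UNIV g)"

definition grad :: "(real ^ 'l \<Rightarrow> real) \<Rightarrow> real ^ 'l \<Rightarrow> real ^ 'l" where
  "grad v x = (THE D. GDERIV v x :> D)"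

text \<open>Row vectors \<open>p\<close> are identified with vectors, so that the product of a row \<open>p\<close> and a column
  \<open>y\<close> is the inner product of \<open>p\<close> and \<open>y\<close>.\<close>

definition hamiltonian ::
  "(real ^ 'l \<Rightarrow> real ^ 'm \<Rightarrow> real ^ 'l) \<Rightarrow> (real ^ 'l \<Rightarrow> real ^ 'm \<Rightarrow> real) \<Rightarrow>
   real ^ 'l \<Rightarrow> real ^ 'm \<Rightarrow> real ^ 'l \<Rightarrow> real"
where
  "hamiltonian f r x u p = r x u + p \<bullet> f x u"

text \<open>Unique solvability is required both for every continuous open-loop action signal and
  for every policy in closed loop.\<close>

locale rl_problem =
  fixes U :: "(real ^ 'm) set"
    and f :: "real ^ 'l \<Rightarrow> real ^ 'm \<Rightarrow> real ^ 'l"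
    and r :: "real ^ 'l \<Rightarrow> real ^ 'm \<Rightarrow> real"
    and \<gamma> :: real
  assumes action_space: "\<exists>S. open S \<and> (U = S \<union> frontier S \<or> U = S)"
    and discount: "0 < \<gamma>" "\<gamma> \<le> 1"
    and f_continuous: "continuous_on (UNIV \<times> U) (\<lambda>(x, u). f x u)"
    and r_continuous: "continuous_on (UNIV \<times> U) (\<lambda>(x, u). r x u)"
    and open_loop_well_posed:
      "\<And>u x. continuous_on {0..} u \<Longrightarrow> u ` {0..} \<subseteq> U \<Longrightarrow>
         \<exists>X. state_trajectory f u x X \<and>
             (\<forall>Y. state_trajectory f u x Y \<longrightarrow> (\<forall>t\<ge>0. Y t = X t))"
    and closed_loop_well_posed:
      "\<And>\<pi> x. policy U \<pi> \<Longrightarrow>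
         \<exists>X. state_trajectory f (\<lambda>t. \<pi> (X t)) x X \<and>
             (\<forall>Y. state_trajectory f (\<lambda>t. \<pi> (Y t)) x Y \<longrightarrow> (\<forall>t\<ge>0. Y t = X t))"
    and r_attains_max:
      "\<exists>x\<^sub>0. \<exists>u\<^sub>0\<in>U. (\<forall>x. \<forall>u\<in>U. r x u \<le> r x\<^sub>0 u\<^sub>0) \<and> (\<gamma> = 1 \<longrightarrow> r x\<^sub>0 u\<^sub>0 = 0)"
    and admissible_exists: "\<exists>\<pi>. admissible U f r \<gamma> \<pi>"
    and admissible_VF_C1: "\<And>v. v \<in> admissible_VFs U f r \<gamma> \<Longrightarrow> C1_fun v"
    and hamiltonian_argmax:
      "\<exists>u_star. continuous_on UNIV (\<lambda>(x, p). u_star x p) \<and>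
           (\<forall>x p. is_arg_max (\<lambda>u. hamiltonian f r x u p) (\<lambda>u. u \<in> U) (u_star x p))"

definition maximal_policy ::
  "(real ^ 'm) set \<Rightarrow> (real ^ 'l \<Rightarrow> real ^ 'm \<Rightarrow> real ^ 'l) \<Rightarrow> (real ^ 'l \<Rightarrow> real ^ 'm \<Rightarrow> real) \<Rightarrow> real \<Rightarrow>
   (real ^ 'l \<Rightarrow> real ^ 'm) \<Rightarrow> (real ^ 'l \<Rightarrow> real ^ 'm) \<Rightarrow> bool"
where
  "maximal_policy U f r \<gamma> \<pi> \<pi>' \<longleftrightarrow> admissible U f r \<gamma> \<pi> \<and> policy U \<pi>' \<and>
     (\<forall>x. is_arg_max (\<lambda>u. hamiltonian f r x u (grad (real_value_fun f r \<gamma> \<pi>) x))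
            (\<lambda>u. u \<in> U) (\<pi>' x))"

text \<open>Sequences \<open>\<pi>\<^sub>0, v\<^sub>1, \<pi>\<^sub>1, v\<^sub>2, \<pi>\<^sub>2, \<dots>\<close>; the entry \<open>v 0\<close> is unused.\<close>

definition DPI ::
  "(real ^ 'm) set \<Rightarrow> (real ^ 'l \<Rightarrow> real ^ 'm \<Rightarrow> real ^ 'l) \<Rightarrow> (real ^ 'l \<Rightarrow> real ^ 'm \<Rightarrow> real) \<Rightarrow> real \<Rightarrow>
   (nat \<Rightarrow> real ^ 'l \<Rightarrow> real ^ 'm) \<Rightarrow> (nat \<Rightarrow> real ^ 'l \<Rightarrow> real) \<Rightarrow> bool"
where
  "DPI U f r \<gamma> \<pi> v \<longleftrightarrow> admissible U f r \<gamma> (\<pi> 0) \<and>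
     (\<forall>i\<ge>1.
        C1_fun (v i) \<and>
        (\<forall>x. - ln \<gamma> * v i x = hamiltonian f r x (\<pi> (i - 1) x) (grad (v i) x)) \<and>
        policy U (\<pi> i) \<and>
        (\<forall>x. is_arg_max (\<lambda>u. hamiltonian f r x u (grad (v i) x)) (\<lambda>u. u \<in> U) (\<pi> i x)))"

definition IPI ::
  "(real ^ 'm) set \<Rightarrow> (real ^ 'l \<Rightarrow> real ^ 'm \<Rightarrow> real ^ 'l) \<Rightarrow> (real ^ 'l \<Rightarrow> real ^ 'm \<Rightarrow> real) \<Rightarrow> real \<Rightarrow>
   real \<Rightarrow> (real ^ 'l \<Rightarrow> real ^ 'l) \<Rightarrow> (real ^ 'l \<Rightarrow> real ^ 'm \<Rightarrow> real ^ 'l) \<Rightarrow>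
   (nat \<Rightarrow> real ^ 'l \<Rightarrow> real ^ 'm) \<Rightarrow> (nat \<Rightarrow> real ^ 'l \<Rightarrow> real) \<Rightarrow> bool"
where
  "IPI U f r \<gamma> \<eta> f\<^sub>d f\<^sub>c \<pi> v \<longleftrightarrow>
     0 < \<eta> \<and>
     continuous_on UNIV f\<^sub>d \<and> continuous_on (UNIV \<times> U) (\<lambda>(x, u). f\<^sub>c x u) \<and>
     (\<forall>x. \<forall>u\<in>U. f x u = f\<^sub>d x + f\<^sub>c x u) \<and>
     admissible U f r \<gamma> (\<pi> 0) \<and>
     (\<forall>i\<ge>1.
        C1_fun (v i) \<and>
        (\<forall>x. v i x = discounted_return f r \<gamma> (\<pi> (i - 1)) x \<eta>
                     + \<gamma> powr \<eta> * v i (traj f (\<pi> (i - 1)) x \<eta>)) \<and>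
        policy U (\<pi> i) \<and>
        (\<forall>x. is_arg_max (\<lambda>u. r x u + grad (v i) x \<bullet> f\<^sub>c x u) (\<lambda>u. u \<in> U) (\<pi> i x)))"

definition PI_operator ::
  "(real ^ 'm) set \<Rightarrow> (real ^ 'l \<Rightarrow> real ^ 'm \<Rightarrow> real ^ 'l) \<Rightarrow> (real ^ 'l \<Rightarrow> real ^ 'm \<Rightarrow> real) \<Rightarrow> real \<Rightarrow>
   (nat \<Rightarrow> real ^ 'l \<Rightarrow> real ^ 'm) \<Rightarrow> ((real ^ 'l \<Rightarrow> real) \<Rightarrow> (real ^ 'l \<Rightarrow> real)) \<Rightarrow> bool"
where
  "PI_operator U f r \<gamma> \<pi> T \<longleftrightarrow>
     T \<in> admissible_VFs U f r \<gamma> \<rightarrow> admissible_VFs U f r \<gamma> \<and>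
     (\<forall>i\<ge>1. T (real_value_fun f r \<gamma> (\<pi> (i - 1))) = real_value_fun f r \<gamma> (\<pi> i)) \<and>
     (\<forall>v\<in>admissible_VFs U f r \<gamma>. (\<forall>i\<ge>1. v \<noteq> real_value_fun f r \<gamma> (\<pi> (i - 1))) \<longrightarrow>
        (\<exists>\<rho> \<rho>'. v = real_value_fun f r \<gamma> \<rho> \<and> maximal_policy U f r \<gamma> \<rho> \<rho>' \<and>
                T v = real_value_fun f r \<gamma> \<rho>'))"

text \<open>On nonnegative values the supremum over the empty set is \<open>0\<close>; the real \<open>SUP\<close> is
  unspecified there.\<close>

definition sup_pseudometric ::
  "(real ^ 'l) set \<Rightarrow> (real ^ 'l \<Rightarrow> real) \<Rightarrow> (real ^ 'l \<Rightarrow> real) \<Rightarrow> real"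
where
  "sup_pseudometric \<Omega> v w = (if \<Omega> = {} then 0 else SUP x\<in>\<Omega>. \<bar>v x - w x\<bar>)"

definition continuous_wrt :: "('a \<Rightarrow> 'a \<Rightarrow> real) \<Rightarrow> 'a set \<Rightarrow> ('a \<Rightarrow> 'a) \<Rightarrow> bool" where
  "continuous_wrt d V T \<longleftrightarrow>
     (\<forall>v\<in>V. \<forall>\<epsilon>>0. \<exists>\<delta>>0. \<forall>w\<in>V. d v w < \<delta> \<longrightarrow> d (T v) (T w) < \<epsilon>)"

definition locally_uniform_limit ::
  "(nat \<Rightarrow> real ^ 'l \<Rightarrow> real) \<Rightarrow> (real ^ 'l \<Rightarrow> real) \<Rightarrow> bool"
where
  "locally_uniform_limit v w \<longleftrightarrow>
     (\<forall>x. \<exists>N. open N \<and> x \<in> N \<and> uniform_limit N v w sequentially)"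

end

theory Submission
  imports Defs
begin

text \<open>Both evaluation steps return the value function of the previous policy: the boundary
  condition removes the remainder of the return in the differential identity (DPI) and in the
  iterated integral identity (IPI). An admissible value function satisfies the HJB equation of its
  policy, so along a trajectory of an improved policy the accumulated reward plus the discounted
  old value is nondecreasing. Since value functions are bounded above by a constant, and by \<open>0\<close>
  when \<open>\<gamma> = 1\<close>, the discounted old value is asymptotically at most \<open>0\<close>; hence the values
  increase, pointwise to their supremum. Continuity of \<open>T\<close> for the pseudometrics of singletons
  already makes the supremum a fixed point of \<open>T\<close>, and Dini's theorem upgrades the pointwise
  convergence to uniform convergence on compact balls.\<close>

section \<open>Monotone limits and Dini's theorem\<close>

lemma antimono_tendsto_INF:
  fixes G :: "real \<Rightarrow> ereal"
  assumes "\<And>s t. a \<le> s \<Longrightarrow> s \<le> t \<Longrightarrow> G t \<le> G s"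
  shows "(G \<longlongrightarrow> (INF s\<in>{a..}. G s)) at_top"
proof (rule order_tendstoI)
  fix y assume "y < (INF s\<in>{a..}. G s)"
  then have "y < G s" if "s \<ge> a" for s
    using that by (meson INF_lower atLeast_iff less_le_trans)
  then show "\<forall>\<^sub>F s in at_top. y < G s"
    by (rule eventually_mono[OF eventually_ge_at_top[of a]])
next
  fix y assume "(INF s\<in>{a..}. G s) < y"
  then obtain s where "s \<ge> a" "G s < y"
    by (auto simp: INF_less_iff)
  then have "G t < y" if "t \<ge> s" for t
    using assms[of s t] that by auto
  then show "\<forall>\<^sub>F s in at_top. G s < y"
    by (rule eventually_mono[OF eventually_ge_at_top[of s]])
qed

text \<open>The sets \<open>C n\<close> on which the gap to the limit is at least \<open>e\<close>
  are compact and decreasing, and pointwise convergence makes their intersection empty. By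
  compactness some \<open>C N\<close> is empty, and monotonicity carries the estimate to all later
  indices.\<close>

lemma Dini_uniform_limit:
  fixes w :: "nat \<Rightarrow> 'a::heine_borel \<Rightarrow> real"
  assumes "compact K" and cont: "\<And>n. continuous_on K (w n)" and contl: "continuous_on K l"
    and mono: "\<And>m n x. x \<in> K \<Longrightarrow> m \<le> n \<Longrightarrow> w m x \<le> w n x"
    and lim: "\<And>x. x \<in> K \<Longrightarrow> (\<lambda>n. w n x) \<longlonglongrightarrow> l x"
  shows "uniform_limit K w l sequentially"
proof (rule uniform_limitI)
  fix e :: real assume "e > 0"
  define C where "C n = {x \<in> K. e \<le> l x - w n x}" for n
  have "compact (C n)" for n
  proof -
    have "closedin (top_of_set K) (K \<inter> (\<lambda>x. l x - w n x) -` {e..})"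
      by (intro continuous_closedin_preimage continuous_on_diff contl cont) auto
    then have "compact (K \<inter> (\<lambda>x. l x - w n x) -` {e..})"
      using \<open>compact K\<close> closedin_compact by blast
    also have "K \<inter> (\<lambda>x. l x - w n x) -` {e..} = C n"
      by (auto simp: C_def)
    finally show ?thesis .
  qed
  moreover have "C n \<subseteq> C m" if "m \<le> n" for m n
    using mono[of _ m n] that by (force simp: C_def)
  moreover have "\<Inter>(range C) = {}"
  proof (rule ccontr)
    assume "\<Inter>(range C) \<noteq> {}"
    then obtain x where x: "\<And>n. x \<in> C n" by blast
    then have "x \<in> K" by (auto simp: C_def)
    from order_tendstoD(1)[OF lim[OF this], of "l x - e"] \<open>e > 0\<close>
    obtain n where "l x - e < w n x"
      by (auto simp: eventually_sequentially)
    with x[of n] show False by (auto simp: C_def)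
  qed
  ultimately obtain N where N: "C N = {}"
    using compact_nest[of C] by metis
  have "dist (w n x) (l x) < e" if "n \<ge> N" "x \<in> K" for n x
  proof -
    have "w n x \<le> l x"
      using lim[OF \<open>x \<in> K\<close>] mono[OF \<open>x \<in> K\<close>] by (intro incseq_le) (auto simp: incseq_def)
    moreover have "l x - w N x < e"
      using N \<open>x \<in> K\<close> by (force simp: C_def)
    ultimately show ?thesis
      using mono[OF \<open>x \<in> K\<close> \<open>n \<ge> N\<close>] by (simp add: dist_real_def)
  qed
  then show "\<forall>\<^sub>F n in sequentially. \<forall>x\<in>K. dist (w n x) (l x) < e"
    by (auto simp: eventually_sequentially)
qed

section \<open>Gradients and the chain rule along curves\<close>

text \<open>Derivatives are unique, so the definite description \<open>grad\<close> coincides with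
  the witness in \<open>C1_fun\<close> and inherits its continuity.\<close>

lemma C1_fun_gradD:
  assumes "C1_fun w"
  shows "GDERIV w x :> grad w x" and "continuous_on UNIV (grad w)"
proof -
  obtain g where g: "\<And>x. GDERIV w x :> g x" "continuous_on UNIV g"
    using assms by (auto simp: C1_fun_def)
  have "grad w x = g x" for x
    unfolding grad_def
  proof (rule the_equality)
    fix D assume "GDERIV w x :> D"
    then have "(\<lambda>h. h \<bullet> D) = (\<lambda>h. h \<bullet> g x)"
      using g(1) unfolding gderiv_def by (rule has_derivative_unique)
    then show "D = g x"
      by (metis vector_eq_ldot)
  qed (rule g(1))
  then have "grad w = g" by blast
  with g show "GDERIV w x :> grad w x" "continuous_on UNIV (grad w)" by auto
qed

lemma C1_fun_continuous_on: "C1_fun w \<Longrightarrow> continuous_on A w"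
  using C1_fun_gradD(1)[of w] unfolding gderiv_def
  by (meson continuous_at_imp_continuous_on has_derivative_continuous)

text \<open>The derivative of the curve is taken within \<open>S\<close> because trajectories have
  only a one-sided derivative at time \<open>0\<close>.\<close>

lemma GDERIV_chain_vector:
  assumes "GDERIV w (X t) :> D" and "(X has_vector_derivative Y) (at t within S)"
  shows "((\<lambda>t. w (X t)) has_real_derivative D \<bullet> Y) (at t within S)"
proof -
  have "(w has_derivative (\<lambda>h. h \<bullet> D)) (at (X t) within X ` S)"
    using assms(1) unfolding gderiv_def by (rule has_derivative_at_withinI)
  from has_derivative_in_compose[OF assms(2)[unfolded has_vector_derivative_def] this]
  show ?thesis
    unfolding has_field_derivative_def by (simp add: inner_commute mult_commute_abs)
qed

lemma discount_has_real_derivative: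
  "c > 0 \<Longrightarrow> ((\<lambda>t. c powr t) has_real_derivative c powr t * ln c) (at t within S)"
  for c :: real
  unfolding powr_def by (auto intro!: derivative_eq_intros)

section \<open>Closed-loop trajectories\<close>

context rl_problem
begin

abbreviation "J \<equiv> discounted_return f r \<gamma>"
abbreviation "V \<equiv> real_value_fun f r \<gamma>"
abbreviation "adm \<equiv> admissible U f r \<gamma>"
abbreviation "X \<equiv> traj f"
abbreviation "H \<equiv> hamiltonian f r"

lemma traj_0: "policy U \<pi> \<Longrightarrow> X \<pi> x 0 = x"
  and traj_has_vector_derivative: "policy U \<pi> \<Longrightarrow> t \<ge> 0 \<Longrightarrow>
    (X \<pi> x has_vector_derivative f (X \<pi> x t) (\<pi> (X \<pi> x t))) (at t within {0..})"
proof -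
  assume "policy U \<pi>"
  then have "\<exists>Y. state_trajectory f (\<lambda>t. \<pi> (Y t)) x Y"
    using closed_loop_well_posed by blast
  then have *: "state_trajectory f (\<lambda>t. \<pi> (X \<pi> x t)) x (X \<pi> x)"
    unfolding traj_def by (rule someI_ex)
  then show "X \<pi> x 0 = x"
    by (simp add: state_trajectory_def)
  show "(X \<pi> x has_vector_derivative f (X \<pi> x t) (\<pi> (X \<pi> x t))) (at t within {0..})"
    if "t \<ge> 0"
    using * that by (simp add: state_trajectory_def)
qed

lemma traj_unique:
  assumes "policy U \<pi>" "state_trajectory f (\<lambda>t. \<pi> (Y t)) x Y" "t \<ge> 0"
  shows "Y t = X \<pi> x t"
proof -
  have "state_trajectory f (\<lambda>t. \<pi> (X \<pi> x t)) x (X \<pi> x)"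
    using traj_0 traj_has_vector_derivative assms(1) by (simp add: state_trajectory_def)
  then show ?thesis
    using closed_loop_well_posed[OF assms(1), of x] assms(2,3) by metis
qed

text \<open>The closed-loop system is autonomous, so the time-shifted trajectory solves it from
  \<open>X \<pi> x s\<close>; uniqueness then gives the flow property.\<close>

lemma traj_shift:
  assumes "policy U \<pi>" "s \<ge> 0" "t \<ge> 0"
  shows "X \<pi> (X \<pi> x s) t = X \<pi> x (s + t)"
proof -
  have "((\<lambda>t. X \<pi> x (s + t)) has_vector_derivative f (X \<pi> x (s + t)) (\<pi> (X \<pi> x (s + t))))
      (at t within {0..})" if "t \<ge> 0" for t
  proof -
    have "((\<lambda>t. s + t) has_vector_derivative 1) (at t within {0..})"
      by (auto intro!: derivative_eq_intros)
    moreover have "(X \<pi> x has_vector_derivative f (X \<pi> x (s + t)) (\<pi> (X \<pi> x (s + t))))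
        (at (s + t) within (+) s ` {0..})"
      using that \<open>s \<ge> 0\<close>
      by (intro has_vector_derivative_within_subset[OF traj_has_vector_derivative[OF assms(1)]]) auto
    ultimately show ?thesis
      using vector_diff_chain_within[of "(+) s" 1 t "{0..}" "X \<pi> x"] by (simp add: o_def)
  qed
  then have "state_trajectory f (\<lambda>t. \<pi> (X \<pi> x (s + t))) (X \<pi> x s) (\<lambda>t. X \<pi> x (s + t))"
    by (simp add: state_trajectory_def)
  from traj_unique[OF assms(1) this assms(3)] show ?thesis by simp
qed

lemma policy_range: "policy U \<pi> \<Longrightarrow> \<pi> x \<in> U"
  by (auto simp: policy_def)

lemma traj_continuous_on: "policy U \<pi> \<Longrightarrow> continuous_on {0..} (X \<pi> x)"
  by (meson atLeast_iff continuous_on_eq_continuous_within has_vector_derivative_continuous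
      traj_has_vector_derivative)

lemma continuous_on_along_traj:
  assumes "policy U \<pi>" "continuous_on (UNIV \<times> U) (\<lambda>(x, u). g x u)"
  shows "continuous_on {0..} (\<lambda>t. g (X \<pi> x t) (\<pi> (X \<pi> x t)))"
proof -
  have "continuous_on {0..} (\<lambda>t. (X \<pi> x t, \<pi> (X \<pi> x t)))"
    using traj_continuous_on[OF assms(1)] assms(1) unfolding policy_def
    by (intro continuous_on_Pair) (auto intro: continuous_on_compose2)
  from continuous_on_compose2[OF assms(2) this] show ?thesis
    using policy_range[OF assms(1)] by auto
qed

section \<open>Discounted returns over finite horizons\<close>

lemma discounted_reward_continuous_on:
  "policy U \<pi> \<Longrightarrow> continuous_on {0..} (\<lambda>t. \<gamma> powr t * r (X \<pi> x t) (\<pi> (X \<pi> x t)))"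
  using discount(1)
  by (auto intro!: continuous_intros continuous_on_along_traj r_continuous)

lemma discounted_reward_integrable_on:
  assumes "policy U \<pi>" "0 \<le> a"
  shows "(\<lambda>t. \<gamma> powr t * r (X \<pi> x t) (\<pi> (X \<pi> x t))) integrable_on {a..b}"
  using assms(2)
  by (intro integrable_continuous_interval
      continuous_on_subset[OF discounted_reward_continuous_on[OF assms(1)]]) auto

text \<open>After a shift of time, the flow property and \<open>powr_add\<close> turn the return
  collected on \<open>{s..s + t}\<close> into a discounted return restarted at
  \<open>X \<pi> x s\<close>.\<close>

lemma discounted_return_add:
  assumes "policy U \<pi>" "s \<ge> 0" "t \<ge> 0"
  shows "J \<pi> x (s + t) = J \<pi> x s + \<gamma> powr s * J \<pi> (X \<pi> x s) t"
proof -
  let ?g = "\<lambda>t. \<gamma> powr t * r (X \<pi> x t) (\<pi> (X \<pi> x t))"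
  have "J \<pi> x (s + t) = J \<pi> x s + integral {s..s + t} ?g"
    unfolding discounted_return_def
    using Henstock_Kurzweil_Integration.integral_combine[of 0 s "s + t" ?g] assms
    by (simp add: discounted_reward_integrable_on)
  also have "integral {s..s + t} ?g = integral {0..t} (?g \<circ> (+) s)"
    using integral_shift_Icc_real[of 0 t ?g s] by (simp add: add.commute)
  also have "\<dots> = integral {0..t}
      (\<lambda>q. \<gamma> powr s * (\<gamma> powr q * r (X \<pi> (X \<pi> x s) q) (\<pi> (X \<pi> (X \<pi> x s) q))))"
    by (rule integral_cong) (use assms in \<open>simp add: traj_shift powr_add\<close>)
  finally show ?thesis
    unfolding discounted_return_def by simp
qed

section \<open>A priori bounds and existence of the value function\<close>

text \<open>Some upper bound of the reward that vanishes when \<open>\<gamma> = 1\<close>; for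
  \<open>\<gamma> < 1\<close> it may exceed the maximum.\<close>

definition reward_bound :: real where
  "reward_bound = (SOME M. (\<forall>x. \<forall>u\<in>U. r x u \<le> M) \<and> (\<gamma> = 1 \<longrightarrow> M = 0))"

lemma reward_le_bound: "u \<in> U \<Longrightarrow> r x u \<le> reward_bound"
  and reward_bound_undiscounted: "\<gamma> = 1 \<Longrightarrow> reward_bound = 0"
proof -
  have "\<exists>M. (\<forall>x. \<forall>u\<in>U. r x u \<le> M) \<and> (\<gamma> = 1 \<longrightarrow> M = 0)"
    using r_attains_max by blast
  from someI_ex[OF this, folded reward_bound_def]
  show "u \<in> U \<Longrightarrow> r x u \<le> reward_bound" "\<gamma> = 1 \<Longrightarrow> reward_bound = 0" by auto
qed

text \<open>For \<open>\<gamma> = 1\<close> the quotient is \<open>0 / 0 = 0\<close>, which is the correct bound because the maximal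
  reward is then \<open>0\<close>.\<close>

definition return_bound :: "real \<Rightarrow> real" where
  "return_bound s = reward_bound * (1 - \<gamma> powr s) / (- ln \<gamma>)"

text \<open>The discounted return of the constant reward \<open>reward_bound\<close> over the
  infinite horizon, with the same convention \<open>0 / 0 = 0\<close> for
  \<open>\<gamma> = 1\<close>.\<close>

definition value_bound :: real where
  "value_bound = reward_bound / (- ln \<gamma>)"

lemma discount_tendsto_0:
  assumes "\<gamma> < 1"
  shows "((\<lambda>s. \<gamma> powr s) \<longlongrightarrow> 0) at_top"
proof -
  have "filterlim (\<lambda>s. ln \<gamma> * s) at_bot at_top"
    using discount(1) assms
    by (intro filterlim_tendsto_neg_mult_at_bot[OF tendsto_const _ filterlim_ident]) simp
  from filterlim_compose[OF exp_at_bot this] show ?thesis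
    using discount(1) by (simp add: powr_def mult.commute)
qed

text \<open>Treats both regimes at once: for \<open>\<gamma> < 1\<close> the discount decays, and
  for \<open>\<gamma> = 1\<close> the constant itself is \<open>0\<close>. It removes the remainder
  in policy improvement.\<close>

lemma discounted_value_bound_tendsto_0: "((\<lambda>s. \<gamma> powr s * value_bound) \<longlongrightarrow> 0) at_top"
proof (cases "\<gamma> = 1")
  case True
  have "value_bound = 0"
    using reward_bound_undiscounted[OF True] by (simp add: value_bound_def)
  then show ?thesis by simp
next
  case False
  then show ?thesis
    using tendsto_mult_right[OF discount_tendsto_0, of value_bound] discount(2)
    by (simp add: mult.commute)
qed

lemma return_bound_tendsto: "(return_bound \<longlongrightarrow> value_bound) at_top"
proof -
  have "return_bound = (\<lambda>s. value_bound - \<gamma> powr s * value_bound)"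
    unfolding return_bound_def value_bound_def by (simp add: algebra_simps diff_divide_distrib)
  then show ?thesis
    using tendsto_diff[OF tendsto_const discounted_value_bound_tendsto_0, of value_bound]
    by simp
qed

lemma return_bound_has_integral:
  assumes "a \<le> b"
  shows "((\<lambda>t. \<gamma> powr t * reward_bound) has_integral return_bound b - return_bound a) {a..b}"
proof (rule fundamental_theorem_of_calculus[OF assms])
  fix t
  show "(return_bound has_vector_derivative \<gamma> powr t * reward_bound) (at t within {a..b})"
  proof (cases "\<gamma> = 1")
    case True
    have "reward_bound = 0" using True by (rule reward_bound_undiscounted)
    then show ?thesis unfolding return_bound_def by simp
  next
    case False
    then have "ln \<gamma> \<noteq> 0" using discount by simp
    then show ?thesis
      unfolding return_bound_def has_real_derivative_iff_has_vector_derivative[symmetric]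
      using discount(1)
      by (auto intro!: derivative_eq_intros discount_has_real_derivative simp: field_simps)
  qed
qed

lemma discounted_return_increment_le:
  assumes "policy U \<pi>" "0 \<le> s" "s \<le> t"
  shows "J \<pi> x t - J \<pi> x s \<le> return_bound t - return_bound s"
proof -
  let ?g = "\<lambda>t. \<gamma> powr t * r (X \<pi> x t) (\<pi> (X \<pi> x t))"
  note int = discounted_reward_integrable_on[OF assms(1), of _ x]
  have "J \<pi> x t - J \<pi> x s = integral {s..t} ?g"
    unfolding discounted_return_def
    using Henstock_Kurzweil_Integration.integral_combine[of 0 s t ?g] int[of 0 t] assms by simp
  also have "(?g has_integral integral {s..t} ?g) {s..t}"
    using int assms by (simp add: integrable_integral)
  then have "integral {s..t} ?g \<le> return_bound t - return_bound s"
    by (rule has_integral_le[OF _ return_bound_has_integral[OF assms(3)]])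
      (use reward_le_bound policy_range[OF assms(1)] in \<open>simp add: mult_left_mono\<close>)
  finally show ?thesis .
qed

text \<open>The return minus its a priori bound is nonincreasing in time, so the limit defining the value
  function exists in the extended reals.\<close>

lemma return_tendsto_value_fun:
  assumes "policy U \<pi>"
  shows "((\<lambda>s. ereal (J \<pi> x s)) \<longlongrightarrow> value_fun f r \<gamma> \<pi> x) at_top"
    and "value_fun f r \<gamma> \<pi> x \<le> ereal value_bound"
proof -
  let ?G = "\<lambda>s. ereal (J \<pi> x s - return_bound s)"
  define L where "L = (INF s\<in>{0..}. ?G s)"
  have "(?G \<longlongrightarrow> L) at_top"
    unfolding L_def
    by (rule antimono_tendsto_INF)
      (use discounted_return_increment_le[OF assms, of _ _ x] in \<open>simp add: algebra_simps\<close>)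
  moreover have "((\<lambda>s. ereal (return_bound s)) \<longlongrightarrow> ereal value_bound) at_top"
    using return_bound_tendsto by simp
  \<comment> \<open>\<open>L\<close> may be minus infinity; the limits can still be added because
    the other one is finite.\<close>
  ultimately have "((\<lambda>s. ?G s + ereal (return_bound s)) \<longlongrightarrow> L + ereal value_bound) at_top"
    by (intro tendsto_add_ereal_general1) auto
  then have *: "((\<lambda>s. ereal (J \<pi> x s)) \<longlongrightarrow> L + ereal value_bound) at_top"
    by simp
  then have eq: "value_fun f r \<gamma> \<pi> x = L + ereal value_bound"
    unfolding value_fun_def by (rule tendsto_Lim[OF trivial_limit_at_top_linorder])
  with * show "((\<lambda>s. ereal (J \<pi> x s)) \<longlongrightarrow> value_fun f r \<gamma> \<pi> x) at_top"
    by simp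
  \<comment> \<open>At time \<open>0\<close> both the return and its bound vanish, so the infimum is
    at most \<open>0\<close>; this gives the upper bound on the value.\<close>
  have "L \<le> ?G 0"
    unfolding L_def by (rule INF_lower) simp
  also have "?G 0 = 0"
    using discount(1) by (simp add: discounted_return_def return_bound_def)
  finally have "L + ereal value_bound \<le> 0 + ereal value_bound"
    by (rule add_right_mono)
  then show "value_fun f r \<gamma> \<pi> x \<le> ereal value_bound"
    using eq by simp
qed

section \<open>Bellman and HJB equations for admissible policies\<close>

lemma admissible_policy: "adm \<pi> \<Longrightarrow> policy U \<pi>"
  by (simp add: admissible_def)

lemma value_fun_eq_real: "adm \<pi> \<Longrightarrow> value_fun f r \<gamma> \<pi> x = ereal (V \<pi> x)"
  by (simp add: admissible_def real_value_fun_def ereal_real)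

lemma return_tendsto_real_value: "adm \<pi> \<Longrightarrow> (J \<pi> x \<longlongrightarrow> V \<pi> x) at_top"
  using return_tendsto_value_fun(1)[OF admissible_policy] by (simp add: value_fun_eq_real)

lemma real_value_le_bound: "adm \<pi> \<Longrightarrow> V \<pi> x \<le> value_bound"
  using return_tendsto_value_fun(2)[OF admissible_policy] by (simp add: value_fun_eq_real)

lemma admissible_VF_mem: "adm \<pi> \<Longrightarrow> V \<pi> \<in> admissible_VFs U f r \<gamma>"
  by (auto simp: admissible_VFs_def)

text \<open>Let the second duration tend to infinity in \<open>discounted_return_add\<close>; both
  sides converge by admissibility.\<close>

lemma Bellman_equation:
  assumes "adm \<pi>" "s \<ge> 0"
  shows "V \<pi> x = J \<pi> x s + \<gamma> powr s * V \<pi> (X \<pi> x s)"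
proof (rule tendsto_unique[OF trivial_limit_at_top_linorder])
  have "filterlim (\<lambda>t. s + t) at_top at_top"
    by (rule filterlim_tendsto_add_at_top[OF tendsto_const filterlim_ident])
  then show "((\<lambda>t. J \<pi> x (s + t)) \<longlongrightarrow> V \<pi> x) at_top"
    using filterlim_compose[OF return_tendsto_real_value[OF assms(1)]] by blast
  have "((\<lambda>t. J \<pi> x s + \<gamma> powr s * J \<pi> (X \<pi> x s) t)
      \<longlongrightarrow> J \<pi> x s + \<gamma> powr s * V \<pi> (X \<pi> x s)) at_top"
    by (intro tendsto_intros return_tendsto_real_value assms(1))
  moreover have "\<forall>\<^sub>F t in at_top. J \<pi> x s + \<gamma> powr s * J \<pi> (X \<pi> x s) t = J \<pi> x (s + t)"
    by (rule eventually_mono[OF eventually_ge_at_top[of 0]])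
      (rule discounted_return_add[OF admissible_policy[OF assms(1)] assms(2), symmetric])
  ultimately show "((\<lambda>t. J \<pi> x (s + t)) \<longlongrightarrow> J \<pi> x s + \<gamma> powr s * V \<pi> (X \<pi> x s)) at_top"
    by (rule Lim_transform_eventually)
qed

text \<open>A deterministic analogue of Dynkin's formula.\<close>

lemma return_plus_discounted_has_integral:
  assumes "policy U \<pi>" "C1_fun w" "s \<ge> 0"
  shows "((\<lambda>t. \<gamma> powr t * (ln \<gamma> * w (X \<pi> x t) + H (X \<pi> x t) (\<pi> (X \<pi> x t)) (grad w (X \<pi> x t))))
      has_integral (J \<pi> x s + \<gamma> powr s * w (X \<pi> x s) - w x)) {0..s}"
proof -
  let ?r = "\<lambda>t. \<gamma> powr t * r (X \<pi> x t) (\<pi> (X \<pi> x t))"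
  let ?d = "\<lambda>t. \<gamma> powr t * (grad w (X \<pi> x t) \<bullet> f (X \<pi> x t) (\<pi> (X \<pi> x t)))
                + \<gamma> powr t * ln \<gamma> * w (X \<pi> x t)"
  have "((\<lambda>t. \<gamma> powr t * w (X \<pi> x t)) has_vector_derivative ?d t) (at t within {0..s})"
    if "t \<in> {0..s}" for t
  proof -
    have "(X \<pi> x has_vector_derivative f (X \<pi> x t) (\<pi> (X \<pi> x t))) (at t within {0..s})"
      using that
      by (intro has_vector_derivative_within_subset[OF traj_has_vector_derivative[OF assms(1)]]) auto
    from DERIV_mult[OF discount_has_real_derivative[OF discount(1)]
        GDERIV_chain_vector[OF C1_fun_gradD(1)[OF assms(2)] this]]
    show ?thesis
      by (simp add: has_real_derivative_iff_has_vector_derivative[symmetric] algebra_simps)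
  qed
  from fundamental_theorem_of_calculus[OF assms(3) this]
  have "(?d has_integral \<gamma> powr s * w (X \<pi> x s) - w x) {0..s}"
    using traj_0[OF assms(1)] discount(1) by simp
  moreover have "(?r has_integral J \<pi> x s) {0..s}"
    unfolding discounted_return_def
    by (intro integrable_integral discounted_reward_integrable_on assms(1)) simp
  ultimately have "((\<lambda>t. ?r t + ?d t) has_integral J \<pi> x s + (\<gamma> powr s * w (X \<pi> x s) - w x)) {0..s}"
    by (rule has_integral_add[rotated])
  then show ?thesis
    by (simp add: hamiltonian_def algebra_simps)
qed

text \<open>By the Bellman equation the integrand \<open>k\<close> of the Dynkin-type identity has
  integral \<open>0\<close> over every \<open>{0..u}\<close>. As \<open>k\<close> is continuous,
  differentiating at \<open>u = 0\<close> gives \<open>k 0 = 0\<close>, which is the claim at the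
  initial state.\<close>

lemma HJB_equation:
  assumes "adm \<pi>"
  shows "- ln \<gamma> * V \<pi> x = H x (\<pi> x) (grad (V \<pi>) x)"
proof -
  have pol: "policy U \<pi>" using assms by (rule admissible_policy)
  have C1: "C1_fun (V \<pi>)" using admissible_VF_C1 admissible_VF_mem assms by blast
  define k where "k t = \<gamma> powr t * (ln \<gamma> * V \<pi> (X \<pi> x t)
      + H (X \<pi> x t) (\<pi> (X \<pi> x t)) (grad (V \<pi>) (X \<pi> x t)))" for t
  have "continuous_on {0..} k"
    unfolding k_def hamiltonian_def using discount(1)
    by (auto intro!: continuous_intros continuous_on_along_traj[OF pol r_continuous]
        continuous_on_along_traj[OF pol f_continuous]
        continuous_on_compose2[OF C1_fun_continuous_on[OF C1] traj_continuous_on[OF pol]]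
        continuous_on_compose2[OF C1_fun_gradD(2)[OF C1] traj_continuous_on[OF pol]])
  then have "((\<lambda>u. integral {0..u} k) has_vector_derivative k 0) (at 0 within {0..1})"
    by (intro integral_has_vector_derivative) (auto intro: continuous_on_subset)
  moreover have "integral {0..u} k = 0" if "u \<ge> 0" for u
  proof -
    have "J \<pi> x u + \<gamma> powr u * V \<pi> (X \<pi> x u) - V \<pi> x = 0"
      using Bellman_equation[OF assms that, of x] by simp
    with return_plus_discounted_has_integral[OF pol C1 that, of x]
    show ?thesis unfolding k_def by (metis (no_types, lifting) integral_unique)
  qed
  \<comment> \<open>One-sided derivatives at an endpoint of a nondegenerate interval are unique, so
    comparison with the zero function determines \<open>k 0\<close>.\<close>
  ultimately have "((\<lambda>u. 0) has_vector_derivative k 0) (at 0 within cbox 0 1)"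
    by (subst box_real, intro has_vector_derivative_transform[of 0 "{0..1}" "\<lambda>_. 0"]) auto
  then have "k 0 = 0"
    by (rule vector_derivative_unique_within_closed_interval[rotated 2]) auto
  then show ?thesis
    using discount(1) by (simp add: k_def traj_0[OF pol])
qed

section \<open>Policy improvement\<close>

text \<open>Admissibility of \<open>\<pi>'\<close> is part of the conclusion, so its value is
  compared with \<open>V \<pi>\<close> in the extended reals first. The HJB equation of
  \<open>\<pi>\<close> and \<open>better\<close> make the Dynkin integrand nonnegative along
  trajectories of \<open>\<pi>'\<close>.\<close>

lemma policy_improvement:
  assumes "adm \<pi>" "policy U \<pi>'"
    and better: "\<And>x. H x (\<pi> x) (grad (V \<pi>) x) \<le> H x (\<pi>' x) (grad (V \<pi>) x)"
  shows "adm \<pi>'" and "V \<pi> x \<le> V \<pi>' x"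
proof -
  have C1: "C1_fun (V \<pi>)" using admissible_VF_C1 admissible_VF_mem assms(1) by blast
  have le: "ereal (V \<pi> x) \<le> value_fun f r \<gamma> \<pi>' x" for x
  proof (rule tendsto_le[OF trivial_limit_at_top_linorder return_tendsto_value_fun(1)[OF assms(2)]])
    show "((\<lambda>s. ereal (V \<pi> x - \<gamma> powr s * value_bound)) \<longlongrightarrow> ereal (V \<pi> x)) at_top"
      using tendsto_diff[OF tendsto_const discounted_value_bound_tendsto_0, of "V \<pi> x"] by simp
    \<comment> \<open>Nothing is known about the limit of the discounted \<open>V \<pi>\<close>
      along trajectories of \<open>\<pi>'\<close>, so it is replaced by its constant upper
      bound.\<close>
    have "V \<pi> x - \<gamma> powr s * value_bound \<le> J \<pi>' x s" if "s \<ge> 0" for s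
    proof -
      have "0 \<le> J \<pi>' x s + \<gamma> powr s * V \<pi> (X \<pi>' x s) - V \<pi> x"
      proof (rule has_integral_nonneg[OF return_plus_discounted_has_integral[OF assms(2) C1 that]])
        fix t
        show "0 \<le> \<gamma> powr t * (ln \<gamma> * V \<pi> (X \<pi>' x t)
            + H (X \<pi>' x t) (\<pi>' (X \<pi>' x t)) (grad (V \<pi>) (X \<pi>' x t)))"
          using better[of "X \<pi>' x t"] HJB_equation[OF assms(1), of "X \<pi>' x t"] by simp
      qed
      moreover have "\<gamma> powr s * V \<pi> (X \<pi>' x s) \<le> \<gamma> powr s * value_bound"
        by (intro mult_left_mono real_value_le_bound assms(1)) simp
      ultimately show ?thesis by linarith
    qed
    then show "\<forall>\<^sub>F s in at_top. ereal (V \<pi> x - \<gamma> powr s * value_bound) \<le> ereal (J \<pi>' x s)"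
      by (intro eventually_mono[OF eventually_ge_at_top[of 0]]) simp
  qed
  \<comment> \<open>The old value excludes minus infinity, and \<open>value_bound\<close> excludes
    plus infinity.\<close>
  have "\<bar>value_fun f r \<gamma> \<pi>' x\<bar> \<noteq> \<infinity>" for x
    using le[of x] return_tendsto_value_fun(2)[OF assms(2), of x] by auto
  then show adm': "adm \<pi>'"
    using assms(2) by (simp add: admissible_def)
  show "V \<pi> x \<le> V \<pi>' x"
    using le[of x] by (simp add: value_fun_eq_real[OF adm'])
qed

section \<open>Policy evaluation and one step of DPI or IPI\<close>

text \<open>The equation makes the Dynkin integrand vanish, so return plus discounted
  \<open>w\<close> stays equal to \<open>w x\<close>; the boundary condition removes the second term
  in the limit.\<close>

lemma differential_evaluation:
  assumes "adm \<pi>" "C1_fun w"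
    and eq: "\<And>x. - ln \<gamma> * w x = H x (\<pi> x) (grad w x)"
    and boundary: "\<And>x. ((\<lambda>t. \<gamma> powr t * w (X \<pi> x t)) \<longlongrightarrow> 0) at_top"
  shows "w = V \<pi>"
proof
  fix x
  have "J \<pi> x s + \<gamma> powr s * w (X \<pi> x s) - w x = 0" if "s \<ge> 0" for s
  proof (rule has_integral_unique)
    show "((\<lambda>t. 0) has_integral J \<pi> x s + \<gamma> powr s * w (X \<pi> x s) - w x) {0..s}"
      using return_plus_discounted_has_integral[OF admissible_policy[OF assms(1)] assms(2) that, of x]
      by (simp add: eq[symmetric])
  qed simp
  then have "\<forall>\<^sub>F s in at_top. J \<pi> x s + \<gamma> powr s * w (X \<pi> x s) = w x"
    by (intro eventually_mono[OF eventually_ge_at_top[of 0]]) simp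
  moreover have "((\<lambda>s. J \<pi> x s + \<gamma> powr s * w (X \<pi> x s)) \<longlongrightarrow> V \<pi> x + 0) at_top"
    by (intro tendsto_add return_tendsto_real_value assms(1) boundary)
  ultimately have "((\<lambda>s::real. w x) \<longlongrightarrow> V \<pi> x) at_top"
    using Lim_transform_eventually by fastforce
  then show "w x = V \<pi> x"
    by (simp add: tendsto_const_iff)
qed

text \<open>Applying the identity over successive periods of length \<open>\<eta>\<close> keeps
  return plus discounted \<open>w\<close> equal to \<open>w x\<close> at all multiples of
  \<open>\<eta>\<close>.\<close>

lemma integral_evaluation:
  assumes "adm \<pi>" "\<eta> > 0"
    and eq: "\<And>x. w x = J \<pi> x \<eta> + \<gamma> powr \<eta> * w (X \<pi> x \<eta>)"
    and boundary: "\<And>x. ((\<lambda>t. \<gamma> powr t * w (X \<pi> x t)) \<longlongrightarrow> 0) at_top"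
  shows "w = V \<pi>"
proof
  fix x
  have pol: "policy U \<pi>" using assms(1) by (rule admissible_policy)
  define s where "s n = of_nat n * \<eta>" for n :: nat
  have s_nonneg: "s n \<ge> 0" and s_Suc: "s (Suc n) = s n + \<eta>" for n
    using \<open>\<eta> > 0\<close> by (auto simp: s_def algebra_simps)
  have iter: "J \<pi> x (s n) + \<gamma> powr s n * w (X \<pi> x (s n)) = w x" for n
  proof (induction n)
    case 0
    show ?case
      using discount(1) by (simp add: s_def discounted_return_def traj_0[OF pol])
  next
    case (Suc n)
    have "w (X \<pi> x (s n)) = J \<pi> (X \<pi> x (s n)) \<eta> + \<gamma> powr \<eta> * w (X \<pi> x (s n + \<eta>))"
      using eq[of "X \<pi> x (s n)"] traj_shift[OF pol s_nonneg] \<open>\<eta> > 0\<close> by simp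
    with Suc show ?case
      using discounted_return_add[OF pol s_nonneg, of \<eta> x n] \<open>\<eta> > 0\<close>
      by (simp add: s_Suc powr_add algebra_simps)
  qed
  \<comment> \<open>The boundary condition concerns continuous time; it passes to the sampling times
    because they tend to infinity.\<close>
  have "filterlim s at_top sequentially"
    unfolding s_def using \<open>\<eta> > 0\<close>
    by (intro filterlim_at_top_mult_tendsto_pos[OF tendsto_const] filterlim_real_sequentially)
  moreover have "((\<lambda>t. J \<pi> x t + \<gamma> powr t * w (X \<pi> x t)) \<longlongrightarrow> V \<pi> x + 0) at_top"
    by (intro tendsto_add return_tendsto_real_value assms(1) boundary)
  ultimately have "(\<lambda>n. J \<pi> x (s n) + \<gamma> powr s n * w (X \<pi> x (s n))) \<longlonglongrightarrow> V \<pi> x + 0"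
    using filterlim_compose by blast
  then show "w x = V \<pi> x"
    unfolding iter by (simp add: tendsto_const_iff)
qed

text \<open>The induction step common to both algorithms. The boundary condition is conditional on
  admissibility, which is therefore assumed for \<open>\<pi> n\<close> and passed on to
  \<open>\<pi> (Suc n)\<close>.\<close>

lemma policy_iteration_step:
  assumes PI: "DPI U f r \<gamma> \<pi> v \<or> (\<exists>\<eta> f\<^sub>d f\<^sub>c. IPI U f r \<gamma> \<eta> f\<^sub>d f\<^sub>c \<pi> v)"
    and boundary: "\<And>i x. i \<ge> 1 \<Longrightarrow> adm (\<pi> (i - 1)) \<Longrightarrow>
           ((\<lambda>t. \<gamma> powr t * v i (X (\<pi> (i - 1)) x t)) \<longlongrightarrow> 0) at_top"
    and adm: "adm (\<pi> n)"
  shows "v (Suc n) = V (\<pi> n)" and "adm (\<pi> (Suc n))" and "V (\<pi> n) x \<le> V (\<pi> (Suc n)) x"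
proof -
  note bdry = boundary[of "Suc n", simplified, OF adm]
  have "v (Suc n) = V (\<pi> n) \<and> policy U (\<pi> (Suc n)) \<and>
      (\<forall>x. H x (\<pi> n x) (grad (v (Suc n)) x) \<le> H x (\<pi> (Suc n) x) (grad (v (Suc n)) x))"
    using PI
  proof
    assume "DPI U f r \<gamma> \<pi> v"
    then have D: "C1_fun (v (Suc n))"
        "\<And>x. - ln \<gamma> * v (Suc n) x = H x (\<pi> n x) (grad (v (Suc n)) x)"
        "policy U (\<pi> (Suc n))"
        "\<And>x. is_arg_max (\<lambda>u. H x u (grad (v (Suc n)) x)) (\<lambda>u. u \<in> U) (\<pi> (Suc n) x)"
      unfolding DPI_def by (auto dest!: spec[of _ "Suc n"])
    have "v (Suc n) = V (\<pi> n)"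
      by (rule differential_evaluation[OF adm D(1,2) bdry])
    moreover have "H x (\<pi> n x) (grad (v (Suc n)) x) \<le> H x (\<pi> (Suc n) x) (grad (v (Suc n)) x)" for x
      using D(4)[of x] policy_range[OF admissible_policy[OF adm]] by (auto simp: is_arg_max_linorder)
    ultimately show ?thesis using D(3) by blast
  next
    assume "\<exists>\<eta> f\<^sub>d f\<^sub>c. IPI U f r \<gamma> \<eta> f\<^sub>d f\<^sub>c \<pi> v"
    then obtain \<eta> f\<^sub>d f\<^sub>c where IPI: "IPI U f r \<gamma> \<eta> f\<^sub>d f\<^sub>c \<pi> v" by blast
    have I: "0 < \<eta>" "\<And>x u. u \<in> U \<Longrightarrow> f x u = f\<^sub>d x + f\<^sub>c x u"
      using IPI unfolding IPI_def by blast+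
    have "1 \<le> Suc n" by simp
    with IPI have "(\<forall>x. v (Suc n) x = J (\<pi> (Suc n - 1)) x \<eta>
          + \<gamma> powr \<eta> * v (Suc n) (X (\<pi> (Suc n - 1)) x \<eta>)) \<and> policy U (\<pi> (Suc n)) \<and>
        (\<forall>x. is_arg_max (\<lambda>u. r x u + grad (v (Suc n)) x \<bullet> f\<^sub>c x u) (\<lambda>u. u \<in> U) (\<pi> (Suc n) x))"
      unfolding IPI_def by blast
    then have I': "\<And>x. v (Suc n) x = J (\<pi> n) x \<eta> + \<gamma> powr \<eta> * v (Suc n) (X (\<pi> n) x \<eta>)"
        "policy U (\<pi> (Suc n))"
        "\<And>x. is_arg_max (\<lambda>u. r x u + grad (v (Suc n)) x \<bullet> f\<^sub>c x u) (\<lambda>u. u \<in> U) (\<pi> (Suc n) x)"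
      unfolding diff_Suc_1 by blast+
    have "v (Suc n) = V (\<pi> n)"
      by (rule integral_evaluation[OF adm I(1) I'(1) bdry])
    \<comment> \<open>The contribution of \<open>f\<^sub>d\<close> does not depend on the action, so
      it cancels when the two Hamiltonians are compared.\<close>
    moreover have "H x (\<pi> n x) (grad (v (Suc n)) x) \<le> H x (\<pi> (Suc n) x) (grad (v (Suc n)) x)" for x
      using I'(3)[of x] policy_range[OF admissible_policy[OF adm]] policy_range[OF I'(2)]
      by (auto simp: is_arg_max_linorder hamiltonian_def I(2) inner_add_right)
    ultimately show ?thesis using I'(2) by blast
  qed
  then show "v (Suc n) = V (\<pi> n)" "adm (\<pi> (Suc n))" "V (\<pi> n) x \<le> V (\<pi> (Suc n)) x"
    using policy_improvement[OF adm, of "\<pi> (Suc n)"] by auto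
qed

end

section \<open>The fixed point and locally uniform convergence\<close>

text \<open>On a singleton the pseudometric is the absolute difference at that point, so convergence
  at \<open>x\<close> alone is convergence in the pseudometric.\<close>

lemma continuous_wrt_singleton_tendsto:
  assumes "continuous_wrt (sup_pseudometric {x}) W T" "w \<in> W" "\<And>n. u n \<in> W"
    and lim: "(\<lambda>n. u n x) \<longlonglongrightarrow> w x"
  shows "(\<lambda>n. T (u n) x) \<longlonglongrightarrow> T w x"
proof (rule metric_LIMSEQ_I)
  fix e :: real assume "e > 0"
  then obtain d where d: "d > 0" "\<And>w'. w' \<in> W \<Longrightarrow> \<bar>w x - w' x\<bar> < d \<Longrightarrow> \<bar>T w x - T w' x\<bar> < e"
    using assms(1,2) unfolding continuous_wrt_def sup_pseudometric_def
    by simp (meson \<open>e > 0\<close>)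
  from metric_LIMSEQ_D[OF lim \<open>d > 0\<close>] obtain N where "\<And>n. n \<ge> N \<Longrightarrow> \<bar>w x - u n x\<bar> < d"
    by (auto simp: dist_real_def abs_minus_commute)
  then have "\<forall>n\<ge>N. dist (T (u n) x) (T w x) < e"
    using d(2) assms(3) by (simp add: dist_real_def abs_minus_commute[of "T (u _) x"])
  then show "\<exists>N. \<forall>n\<ge>N. dist (T (u n) x) (T w x) < e" ..
qed

theorem theorem4p6:
  fixes U :: "(real ^ 'm) set"
    and f :: "real ^ 'l \<Rightarrow> real ^ 'm \<Rightarrow> real ^ 'l"
    and r :: "real ^ 'l \<Rightarrow> real ^ 'm \<Rightarrow> real"
    and \<gamma> :: real
    and \<pi> :: "nat \<Rightarrow> real ^ 'l \<Rightarrow> real ^ 'm"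
    and v :: "nat \<Rightarrow> real ^ 'l \<Rightarrow> real"
    and T :: "(real ^ 'l \<Rightarrow> real) \<Rightarrow> (real ^ 'l \<Rightarrow> real)"
    and v_hat v_star :: "real ^ 'l \<Rightarrow> real"
  assumes "rl_problem U f r \<gamma>"
    and "DPI U f r \<gamma> \<pi> v \<or> (\<exists>\<eta> f\<^sub>d f\<^sub>c. IPI U f r \<gamma> \<eta> f\<^sub>d f\<^sub>c \<pi> v)"
    and "\<And>i x. i \<ge> 1 \<Longrightarrow> admissible U f r \<gamma> (\<pi> (i - 1)) \<Longrightarrow>
           ((\<lambda>t. \<gamma> powr t * v i (traj f (\<pi> (i - 1)) x t)) \<longlongrightarrow> 0) at_top"
    and "\<And>x. ereal (v_hat x) = (SUP i\<in>{1..}. ereal (v i x))"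
    and "PI_operator U f r \<gamma> \<pi> T"
    and "v_hat \<in> admissible_VFs U f r \<gamma>"
    and "\<And>\<Omega>. compact \<Omega> \<Longrightarrow>
           continuous_wrt (sup_pseudometric \<Omega>) (admissible_VFs U f r \<gamma>) T"
    and "v_star \<in> admissible_VFs U f r \<gamma>" and "T v_star = v_star"
    and "\<And>w. w \<in> admissible_VFs U f r \<gamma> \<Longrightarrow> T w = w \<Longrightarrow> w = v_star"
  shows "locally_uniform_limit v v_star \<and> v_star = v_hat"
proof -
  interpret rl_problem U f r \<gamma> by (rule assms(1))
  let ?A = "admissible_VFs U f r \<gamma>"
  have adm: "adm (\<pi> n)" for n
  proof (induction n)
    case 0
    show ?case using assms(2) by (auto simp: DPI_def IPI_def)
  qed (rule policy_iteration_step(2)[OF assms(2,3)])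
  note step = policy_iteration_step[OF assms(2,3) adm]
  \<comment> \<open>Reindexing from \<open>0\<close> bypasses the unconstrained entry
    \<open>v 0\<close>: \<open>w n\<close> is \<open>v (Suc n)\<close>.\<close>
  define w where "w n = V (\<pi> n)" for n
  have v_Suc: "v (Suc n) = w n" for n
    using step(1) by (simp add: w_def)
  have w_mem: "w n \<in> ?A" for n
    using adm by (simp add: w_def admissible_VF_mem)
  have inc: "incseq (\<lambda>n. w n x)" for x
    using step(3) by (intro incseq_SucI) (simp add: w_def)
  have lim: "(\<lambda>n. w n x) \<longlonglongrightarrow> v_hat x" for x
  proof -
    have "{1..} = range Suc"
      by (auto simp: image_iff Suc_le_eq gr0_conv_Suc)
    then have eq: "(SUP n. ereal (w n x)) = ereal (v_hat x)"
      using assms(4)[of x] by (simp add: image_image v_Suc)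
    have "incseq (\<lambda>n. ereal (w n x))"
      using inc[of x] by (simp add: incseq_def)
    from LIMSEQ_SUP[OF this] show ?thesis
      unfolding eq by simp
  qed
  \<comment> \<open>Pass to the limit at each point in \<open>T (w n) = w (Suc n)\<close>: the right
    side is a shift of a sequence converging to \<open>v_hat\<close>.\<close>
  have "T v_hat = v_hat"
  proof
    fix x
    have "(\<lambda>n. T (w n) x) \<longlonglongrightarrow> T v_hat x"
      by (rule continuous_wrt_singleton_tendsto[OF assms(7) assms(6) w_mem lim]) simp
    moreover have "T (w n) = w (Suc n)" for n
      using assms(5) unfolding PI_operator_def w_def by (auto dest!: spec[of _ "Suc n"])
    ultimately have "(\<lambda>n. w (Suc n) x) \<longlonglongrightarrow> T v_hat x" by simp
    then show "T v_hat x = v_hat x"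
      using LIMSEQ_Suc[OF lim] LIMSEQ_unique by blast
  qed
  then have eq: "v_star = v_hat"
    using assms(6,10) by simp
  have "uniform_limit (ball x 1) v v_hat sequentially" for x
  proof -
    \<comment> \<open>Dini's theorem needs a continuous limit; \<open>v_hat\<close> is continuous
      because it is itself an admissible value function.\<close>
    have "continuous_on S u" if "u \<in> ?A" for S u
      using admissible_VF_C1[OF that] by (rule C1_fun_continuous_on)
    then have "uniform_limit (cball x 1) w v_hat sequentially"
      using inc lim assms(6) w_mem
      by (intro Dini_uniform_limit) (auto simp: incseq_def)
    then have "uniform_limit (ball x 1) (\<lambda>n. v (Suc n)) v_hat sequentially"
      unfolding v_Suc by (rule uniform_limit_on_subset) auto
    then show ?thesis
      unfolding filterlim_sequentially_Suc .
  qed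
  then have "locally_uniform_limit v v_hat"
    unfolding locally_uniform_limit_def by (meson centre_in_ball open_ball zero_less_one)
  with eq show ?thesis by simp
qed

end
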